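(* Let $S$ be a sup-lattice. The assignment on generators $$(x\otimes y')(u\otimes v')=\begin{cases}0 & \text{if } u\leq y,\\ x\otimes v' & \text{otherwise}\end{cases}\qquad(x,y,u,v\in S)$$ extends to a multiplication making the sup-lattice $S\otimes S^{\mathrm{op}}$ a quantale, denoted $\mathcal{C}(S)$. The assignment $\phi(x\otimes y')=\rho_x\lambda_y$ on generators defines a strong Girard couple $\mathcal{C}(S)\xrightarrow{\phi}\mathcal{Q}(S)$, and the element $$d=\bigvee_{x\in S}(x\otimes x')\in\mathcal{C}(S)$$ is a cyclic dualizing element of this couple.
   Context: A sup-lattice is a complete lattice, with top $1$ and bottom $0$; a sup-homomorphism is a map preserving arbitrary suprema; it is strong if it preserves $1$. Every sup-homomorphism $f:S\to T$ has a right adjoint $f^{\dashv}:T\to S$ (so $f(s)\le t\iff s\le f^{\dashv}(t)$). $S^{\mathrm{op}}$ is the opposite lattice of $S$; the element of $S^{\mathrm{op}}$ corresponding to $y\in S$ is written $y'$. The tensor product $S\otimes T$ is the free sup-lattice on generators $s\otimes t$ ($s\in S,t\in T$) subject to $\bigvee(s_i\otimes t)=(\bigvee s_i)\otimes t$ and $\bigvee(s\otimes t_j)=s\otimes(\bigvee t_j)$ (including empty suprema). A quantale is a sup-lattice with an associative multiplication distributing over arbitrary joins in each variable (no unit required). For a quantale $Q$, a $Q$-bimodule is a sup-lattice $M$ with left and right actions of $Q$ preserving joins in both variables, with $(ab)m=a(bm)$, $m(ab)=(ma)b$, $(am)b=a(mb)$. A $Q$-bimodule homomorphism is a sup-homomorphism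 commuting with both actions. A couple $C\xrightarrow{\phi}Q$ consists of two quantales $C,Q$, a $Q$-bimodule structure on $C$, and a $Q$-bimodule homomorphism $\phi:C\to Q$ with $\phi(c_1)c_2=c_1\phi(c_2)=c_1c_2$ for all $c_1,c_2\in C$. It is strong if $\phi$ is strong. For $d\in C$, $a\in Q$, $c\in C$ put $a\rightarrow d=\bigvee\{c\in C\mid ca\le d\}$, $d\leftarrow a=\bigvee\{c\in C\mid ac\le d\}$, $c\rightarrow d=\bigvee\{a\in Q\mid ac\le d\}$, $d\leftarrow c=\bigvee\{a\in Q\mid ca\le d\}$. The element $d$ is cyclic if $ac\le d\iff ca\le d$ for all $a\in Q,c\in C$; it is dualizing if $d\leftarrow(a\rightarrow d)=(d\leftarrow a)\rightarrow d=a$ for all $a\in Q$ and $d\leftarrow(c\rightarrow d)=(d\leftarrow c)\rightarrow d=c$ for all $c\in C$. The couple is Girard if it has a cyclic dualizing element. $\mathcal{Q}(S)$ is the quantale of sup-homomorphisms $S\to S$, with pointwise suprema and composition as multiplication, $(\alpha\beta)(x)=\alpha(\beta(x))$. For $x\in S$: $\rho_x(y)=x$ if $y\ne0$ and $\rho_x(0)=0$; $\lambda_x(y)=1$ if $y\nleq x$ and $\lambda_x(y)=0$ if $y\le x$. The $\mathcal{Q}(S)$-bimodule structure on $\mathcal{C}(S)=S\otimes S^{\mathrm{op}}$ is determined on generators by $\alpha(x\otimes y')=\alpha(x)\otimes y'$ and $(x\otimes y')\alpha=x\otimes(\alpha^{\dashv}(y))'$. *)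

theory Defs
  imports Main "HOL-Library.Dual_Ordered_Lattice"
begin

section \<open>Sup-homomorphisms\<close>

text \<open>A sup-lattice is a type of class \<^class>\<open>complete_lattice\<close>; \<open>S\<^sup>o\<^sup>p\<close> is the type
  \<open>'a dual\<close>, and \<open>y'\<close> is \<open>dual y\<close>.\<close>

definition sup_hom :: "('a::complete_lattice \<Rightarrow> 'b::complete_lattice) \<Rightarrow> bool" where
  "sup_hom f \<longleftrightarrow> (\<forall>A. f (Sup A) = Sup (f ` A))"

lemma sup_hom_Sup: "sup_hom f \<Longrightarrow> f (Sup A) = Sup (f ` A)"
  by (simp add: sup_hom_def)

lemma sup_hom_mono:
  assumes "sup_hom f" "x \<le> y" shows "f x \<le> f y"
proof -
  have "f (Sup {x, y}) = Sup (f ` {x, y})" using assms(1) by (rule sup_hom_Sup)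
  then have "f y = sup (f x) (f y)" using assms(2) by (simp add: sup_absorb2)
  then show ?thesis by (metis sup_ge1)
qed

definition right_adjoint :: "('a::complete_lattice \<Rightarrow> 'b::complete_lattice) \<Rightarrow> 'b \<Rightarrow> 'a" where
  "right_adjoint f t = Sup {s. f s \<le> t}"

lemma right_adjoint_iff:
  assumes "sup_hom f" shows "f s \<le> t \<longleftrightarrow> s \<le> right_adjoint f t"
proof
  assume "f s \<le> t"
  then show "s \<le> right_adjoint f t" by (simp add: right_adjoint_def Sup_upper)
next
  assume "s \<le> right_adjoint f t"
  then have "f s \<le> f (right_adjoint f t)" using assms by (rule sup_hom_mono[rotated])
  also have "\<dots> \<le> t"
    using assms by (auto simp: right_adjoint_def sup_hom_Sup intro!: Sup_least)
  finally show "f s \<le> t" .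
qed


section \<open>Tensor products of sup-lattices\<close>

text \<open>The sup-lattice presented by the generators \<open>s \<otimes> t\<close> and the relations
  \<open>\<Or>(s\<^sub>i \<otimes> t) = (\<Or>s\<^sub>i) \<otimes> t\<close> and \<open>\<Or>(s \<otimes> t\<^sub>j) = s \<otimes> (\<Or>t\<^sub>j)\<close> is realised, as
  usual for presentations of sup-lattices, by those sets of generators that contain the left-hand
  side of a relation iff they contain its right-hand side.  An element is thus represented by the
  set of all generators below it. The universal property is proved in
  \<open>tensor_universal\<close> below.\<close>

definition tensor_closed :: "('a::complete_lattice \<times> 'b::complete_lattice) set \<Rightarrow> bool" where
  "tensor_closed U \<longleftrightarrow>
     (\<forall>A t. (\<forall>s\<in>A. (s, t) \<in> U) \<longleftrightarrow> (Sup A, t) \<in> U) \<and>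
     (\<forall>s B. (\<forall>t\<in>B. (s, t) \<in> U) \<longleftrightarrow> (s, Sup B) \<in> U)"

lemma tensor_closed_Inter:
  assumes "\<And>U. U \<in> \<U> \<Longrightarrow> tensor_closed U" shows "tensor_closed (\<Inter>\<U>)"
proof -
  have "(\<forall>s\<in>A. (s, t) \<in> \<Inter>\<U>) \<longleftrightarrow> (Sup A, t) \<in> \<Inter>\<U>" for A t
  proof -
    have "(\<forall>s\<in>A. (s, t) \<in> \<Inter>\<U>) \<longleftrightarrow> (\<forall>U\<in>\<U>. \<forall>s\<in>A. (s, t) \<in> U)" by auto
    also have "\<dots> \<longleftrightarrow> (\<forall>U\<in>\<U>. (Sup A, t) \<in> U)"
      by (rule ball_cong[OF refl]) (use assms in \<open>simp add: tensor_closed_def\<close>)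
    finally show ?thesis by simp
  qed
  moreover have "(\<forall>t\<in>B. (s, t) \<in> \<Inter>\<U>) \<longleftrightarrow> (s, Sup B) \<in> \<Inter>\<U>" for s B
  proof -
    have "(\<forall>t\<in>B. (s, t) \<in> \<Inter>\<U>) \<longleftrightarrow> (\<forall>U\<in>\<U>. \<forall>t\<in>B. (s, t) \<in> U)" by auto
    also have "\<dots> \<longleftrightarrow> (\<forall>U\<in>\<U>. (s, Sup B) \<in> U)"
      by (rule ball_cong[OF refl]) (use assms in \<open>simp add: tensor_closed_def\<close>)
    finally show ?thesis by simp
  qed
  ultimately show ?thesis unfolding tensor_closed_def by (intro conjI allI)
qed

typedef (overloaded) ('a::complete_lattice, 'b::complete_lattice) tensor =
  "{U :: ('a \<times> 'b) set. tensor_closed U}"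
  morphisms below_gens Abs_tensor
  by (rule exI[of _ UNIV]) (simp add: tensor_closed_def)

setup_lifting type_definition_tensor

instantiation tensor :: (complete_lattice, complete_lattice) complete_lattice
begin

lift_definition less_eq_tensor :: "('a, 'b) tensor \<Rightarrow> ('a, 'b) tensor \<Rightarrow> bool" is "(\<subseteq>)" .
lift_definition less_tensor :: "('a, 'b) tensor \<Rightarrow> ('a, 'b) tensor \<Rightarrow> bool" is "(\<subset>)" .
lift_definition Inf_tensor :: "('a, 'b) tensor set \<Rightarrow> ('a, 'b) tensor" is "\<lambda>\<U>. \<Inter>\<U>"
  by (rule tensor_closed_Inter) auto
definition Sup_tensor :: "('a, 'b) tensor set \<Rightarrow> ('a, 'b) tensor" where
  "Sup_tensor A = Inf {u. \<forall>a\<in>A. a \<le> u}"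
definition inf_tensor :: "('a, 'b) tensor \<Rightarrow> ('a, 'b) tensor \<Rightarrow> ('a, 'b) tensor" where
  "inf_tensor u v = Inf {u, v}"
definition sup_tensor :: "('a, 'b) tensor \<Rightarrow> ('a, 'b) tensor \<Rightarrow> ('a, 'b) tensor" where
  "sup_tensor u v = Sup {u, v}"
definition bot_tensor :: "('a, 'b) tensor" where "bot_tensor = Sup {}"
definition top_tensor :: "('a, 'b) tensor" where "top_tensor = Inf {}"

instance
proof
  fix x y z :: "('a, 'b) tensor" and A :: "('a, 'b) tensor set"
  show "(x < y) = (x \<le> y \<and> \<not> y \<le> x)" by transfer auto
  show "x \<le> x" by transfer auto
  show "x \<le> y \<Longrightarrow> y \<le> z \<Longrightarrow> x \<le> z" by transfer auto
  show "x \<le> y \<Longrightarrow> y \<le> x \<Longrightarrow> x = y" by transfer auto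
  have Inf1: "Inf B \<le> b" if "b \<in> B" for b and B :: "('a, 'b) tensor set"
    using that by transfer auto
  have Inf2: "b \<le> Inf B" if "\<And>w. w \<in> B \<Longrightarrow> b \<le> w" for b and B :: "('a, 'b) tensor set"
    using that by transfer blast
  have Sup1: "b \<le> Sup B" if "b \<in> B" for b and B :: "('a, 'b) tensor set"
    unfolding Sup_tensor_def using that by (intro Inf2) auto
  have Sup2: "Sup B \<le> b" if "\<And>w. w \<in> B \<Longrightarrow> w \<le> b" for b and B :: "('a, 'b) tensor set"
    unfolding Sup_tensor_def using that by (intro Inf1) auto
  show "inf x y \<le> x" "inf x y \<le> y" unfolding inf_tensor_def by (auto intro: Inf1)
  show "x \<le> y \<Longrightarrow> x \<le> z \<Longrightarrow> x \<le> inf y z" unfolding inf_tensor_def by (auto intro: Inf2)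
  show "x \<le> sup x y" "y \<le> sup x y" unfolding sup_tensor_def by (auto intro: Sup1)
  show "y \<le> x \<Longrightarrow> z \<le> x \<Longrightarrow> sup y z \<le> x" unfolding sup_tensor_def by (auto intro: Sup2)
  show "x \<in> A \<Longrightarrow> Inf A \<le> x" by (rule Inf1)
  show "(\<And>x. x \<in> A \<Longrightarrow> z \<le> x) \<Longrightarrow> z \<le> Inf A" by (rule Inf2)
  show "x \<in> A \<Longrightarrow> x \<le> Sup A" by (rule Sup1)
  show "(\<And>x. x \<in> A \<Longrightarrow> x \<le> z) \<Longrightarrow> Sup A \<le> z" by (rule Sup2)
  show "Inf {} = (top :: ('a, 'b) tensor)" by (simp add: top_tensor_def)
  show "Sup {} = (bot :: ('a, 'b) tensor)" by (simp add: bot_tensor_def)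
qed

end

lift_definition tensor_gen ::
  "'a::complete_lattice \<Rightarrow> 'b::complete_lattice \<Rightarrow> ('a, 'b) tensor" (infix "\<otimes>" 75)
  is "\<lambda>s t. \<Inter>{U. tensor_closed U \<and> (s, t) \<in> U}"
  by (rule tensor_closed_Inter) simp

lemma tensor_gen_le_iff: "s \<otimes> t \<le> u \<longleftrightarrow> (s, t) \<in> below_gens u"
  by transfer blast

lemma tensor_le_iff:
  fixes u v :: "('a::complete_lattice, 'b::complete_lattice) tensor"
  shows "u \<le> v \<longleftrightarrow> (\<forall>s t. s \<otimes> t \<le> u \<longrightarrow> s \<otimes> t \<le> v)"
  unfolding tensor_gen_le_iff by transfer auto

lemma Sup_tensor_gen_le_iff: "Sup A \<otimes> t \<le> u \<longleftrightarrow> (\<forall>s\<in>A. s \<otimes> t \<le> u)"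
  unfolding tensor_gen_le_iff by transfer (simp add: tensor_closed_def)

lemma tensor_gen_Sup_le_iff: "s \<otimes> Sup B \<le> u \<longleftrightarrow> (\<forall>t\<in>B. s \<otimes> t \<le> u)"
  unfolding tensor_gen_le_iff by transfer (simp add: tensor_closed_def)

lemma Sup_tensor_gen: "Sup A \<otimes> t = (SUP s\<in>A. s \<otimes> t)"
proof (rule order.antisym)
  show "Sup A \<otimes> t \<le> (SUP s\<in>A. s \<otimes> t)"
    unfolding Sup_tensor_gen_le_iff by (intro ballI SUP_upper)
  show "(SUP s\<in>A. s \<otimes> t) \<le> Sup A \<otimes> t"
    using Sup_tensor_gen_le_iff[of A t "Sup A \<otimes> t"] by (intro SUP_least) simp
qed

lemma tensor_gen_Sup: "s \<otimes> Sup B = (SUP t\<in>B. s \<otimes> t)"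
proof (rule order.antisym)
  show "s \<otimes> Sup B \<le> (SUP t\<in>B. s \<otimes> t)"
    unfolding tensor_gen_Sup_le_iff by (intro ballI SUP_upper)
  show "(SUP t\<in>B. s \<otimes> t) \<le> s \<otimes> Sup B"
    using tensor_gen_Sup_le_iff[of s B "s \<otimes> Sup B"] by (intro SUP_least) simp
qed

lemma tensor_eq_Sup_gens: "u = Sup {s \<otimes> t |s t. s \<otimes> t \<le> u}"
proof (rule order.antisym)
  show "u \<le> Sup {s \<otimes> t |s t. s \<otimes> t \<le> u}"
    unfolding tensor_le_iff[of u] by (auto intro!: Sup_upper)
  show "Sup {s \<otimes> t |s t. s \<otimes> t \<le> u} \<le> u" by (auto intro: Sup_least)
qed

theorem tensor_universal:
  fixes f :: "'a::complete_lattice \<Rightarrow> 'b::complete_lattice \<Rightarrow> 'c::complete_lattice"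
  assumes f1: "\<And>t. sup_hom (\<lambda>s. f s t)" and f2: "\<And>s. sup_hom (f s)"
  shows "\<exists>!g. sup_hom g \<and> (\<forall>s t. g (s \<otimes> t) = f s t)"
proof (rule ex1I)
  define g where "g u = Sup {f s t |s t. s \<otimes> t \<le> u}" for u
  have closed: "tensor_closed {(s, t). f s t \<le> z}" for z
    using sup_hom_Sup[OF f1] sup_hom_Sup[OF f2] by (auto simp: tensor_closed_def Sup_le_iff)
  define h where "h z = Abs_tensor {(s, t). f s t \<le> z}" for z
  have h: "s \<otimes> t \<le> h z \<longleftrightarrow> f s t \<le> z" for s t z
    using closed[of z] by (simp add: tensor_gen_le_iff h_def Abs_tensor_inverse)
  have adj: "g u \<le> z \<longleftrightarrow> u \<le> h z" for u z
    unfolding tensor_le_iff[of u] h by (auto simp: g_def Sup_le_iff)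
  have "g (Sup A) = Sup (g ` A)" for A
  proof (rule order.antisym)
    have "a \<le> h (Sup (g ` A))" if "a \<in> A" for a
      using that by (simp add: adj[symmetric] Sup_upper)
    then show "g (Sup A) \<le> Sup (g ` A)" unfolding adj by (rule Sup_least)
    have "g a \<le> g (Sup A)" if "a \<in> A" for a
    proof -
      have "a \<le> Sup A" using that by (rule Sup_upper)
      also have "\<dots> \<le> h (g (Sup A))" by (simp add: adj[symmetric])
      finally show ?thesis by (simp add: adj)
    qed
    then show "Sup (g ` A) \<le> g (Sup A)" by (rule SUP_least)
  qed
  moreover have "g (s \<otimes> t) = f s t" for s t
  proof (rule order.antisym)
    show "g (s \<otimes> t) \<le> f s t" by (simp add: adj h)
    show "f s t \<le> g (s \<otimes> t)" by (auto simp: g_def intro!: Sup_upper)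
  qed
  ultimately show "sup_hom g \<and> (\<forall>s t. g (s \<otimes> t) = f s t)" by (simp add: sup_hom_def)
  fix k assume k: "sup_hom k \<and> (\<forall>s t. k (s \<otimes> t) = f s t)"
  show "k = g"
  proof
    fix u
    have "k u = k (Sup {s \<otimes> t |s t. s \<otimes> t \<le> u})" by (rule arg_cong[OF tensor_eq_Sup_gens])
    also have "\<dots> = Sup (k ` {s \<otimes> t |s t. s \<otimes> t \<le> u})" using k by (simp add: sup_hom_def)
    also have "k ` {s \<otimes> t |s t. s \<otimes> t \<le> u} = {f s t |s t. s \<otimes> t \<le> u}"
      using k by (fastforce simp: image_iff)
    finally show "k u = g u" by (simp add: g_def)
  qed
qed


section \<open>Quantales, bimodules and Girard couples\<close>

locale quantale =
  fixes mult :: "'q::complete_lattice \<Rightarrow> 'q \<Rightarrow> 'q"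
  assumes mult_assoc: "mult (mult a b) c = mult a (mult b c)"
    and mult_sup_hom_left: "sup_hom (\<lambda>a. mult a b)"
    and mult_sup_hom_right: "sup_hom (\<lambda>b. mult a b)"

text \<open>\<open>lact a m\<close> is \<open>am\<close>, whereas \<open>ract m a\<close> is \<open>ma\<close>.\<close>

locale bimodule = quantale mult
  for mult :: "'q::complete_lattice \<Rightarrow> 'q \<Rightarrow> 'q" +
  fixes lact :: "'q \<Rightarrow> 'm::complete_lattice \<Rightarrow> 'm"
    and ract :: "'m \<Rightarrow> 'q \<Rightarrow> 'm"
  assumes lact_sup_hom_left: "sup_hom (\<lambda>a. lact a m)"
    and lact_sup_hom_right: "sup_hom (\<lambda>m. lact a m)"
    and ract_sup_hom_left: "sup_hom (\<lambda>m. ract m a)"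
    and ract_sup_hom_right: "sup_hom (\<lambda>a. ract m a)"
    and lact_mult: "lact (mult a b) m = lact a (lact b m)"
    and ract_mult: "ract m (mult a b) = ract (ract m a) b"
    and lact_ract: "ract (lact a m) b = lact a (ract m b)"

definition bimodule_hom ::
  "('q \<Rightarrow> 'm::complete_lattice \<Rightarrow> 'm) \<Rightarrow> ('m \<Rightarrow> 'q \<Rightarrow> 'm) \<Rightarrow>
   ('q \<Rightarrow> 'n::complete_lattice \<Rightarrow> 'n) \<Rightarrow> ('n \<Rightarrow> 'q \<Rightarrow> 'n) \<Rightarrow> ('m \<Rightarrow> 'n) \<Rightarrow> bool" where
  "bimodule_hom lactM ractM lactN ractN f \<longleftrightarrow>
     sup_hom f \<and> (\<forall>a m. f (lactM a m) = lactN a (f m)) \<and> (\<forall>m a. f (ractM m a) = ractN (f m) a)"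

locale couple = C: quantale multC + Q: quantale multQ + bimodule multQ lact ract
  for multC :: "'c::complete_lattice \<Rightarrow> 'c \<Rightarrow> 'c"
    and multQ :: "'q::complete_lattice \<Rightarrow> 'q \<Rightarrow> 'q"
    and lact :: "'q \<Rightarrow> 'c \<Rightarrow> 'c"
    and ract :: "'c \<Rightarrow> 'q \<Rightarrow> 'c" +
  fixes \<phi> :: "'c \<Rightarrow> 'q"
  assumes phi_hom: "bimodule_hom lact ract multQ multQ \<phi>"
    and lact_phi: "lact (\<phi> c1) c2 = multC c1 c2"
    and ract_phi: "ract c1 (\<phi> c2) = multC c1 c2"

text \<open>The four residuals \<open>a \<rightarrow> d\<close>, \<open>d \<leftarrow> a\<close>, \<open>c \<rightarrow> d\<close>, \<open>d \<leftarrow> c\<close> for \<open>a\<close> in \<open>Q\<close> and \<open>c\<close>, \<open>d\<close> in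
  \<open>C\<close>; the subscript tells where the argument other than \<open>d\<close> lives.\<close>

definition arrow\<^sub>Q :: "('c::complete_lattice \<Rightarrow> 'q \<Rightarrow> 'c) \<Rightarrow> 'q \<Rightarrow> 'c \<Rightarrow> 'c" where
  "arrow\<^sub>Q ract a d = Sup {c. ract c a \<le> d}"

definition coarrow\<^sub>Q :: "('q \<Rightarrow> 'c::complete_lattice \<Rightarrow> 'c) \<Rightarrow> 'c \<Rightarrow> 'q \<Rightarrow> 'c" where
  "coarrow\<^sub>Q lact d a = Sup {c. lact a c \<le> d}"

definition arrow\<^sub>C :: "('q::complete_lattice \<Rightarrow> 'c::complete_lattice \<Rightarrow> 'c) \<Rightarrow> 'c \<Rightarrow> 'c \<Rightarrow> 'q" where
  "arrow\<^sub>C lact c d = Sup {a. lact a c \<le> d}"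

definition coarrow\<^sub>C :: "('c::complete_lattice \<Rightarrow> 'q::complete_lattice \<Rightarrow> 'c) \<Rightarrow> 'c \<Rightarrow> 'c \<Rightarrow> 'q" where
  "coarrow\<^sub>C ract d c = Sup {a. ract c a \<le> d}"

definition cyclic ::
  "('q \<Rightarrow> 'c::complete_lattice \<Rightarrow> 'c) \<Rightarrow> ('c \<Rightarrow> 'q \<Rightarrow> 'c) \<Rightarrow> 'c \<Rightarrow> bool" where
  "cyclic lact ract d \<longleftrightarrow> (\<forall>a c. lact a c \<le> d \<longleftrightarrow> ract c a \<le> d)"

definition dualizing ::
  "('q::complete_lattice \<Rightarrow> 'c::complete_lattice \<Rightarrow> 'c) \<Rightarrow> ('c \<Rightarrow> 'q \<Rightarrow> 'c) \<Rightarrow> 'c \<Rightarrow> bool" where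
  "dualizing lact ract d \<longleftrightarrow>
     (\<forall>a. coarrow\<^sub>C ract d (arrow\<^sub>Q ract a d) = a \<and> arrow\<^sub>C lact (coarrow\<^sub>Q lact d a) d = a) \<and>
     (\<forall>c. coarrow\<^sub>Q lact d (arrow\<^sub>C lact c d) = c \<and> arrow\<^sub>Q ract (coarrow\<^sub>C ract d c) d = c)"

locale strong_couple = couple +
  assumes phi_top: "\<phi> top = top"

locale girard_couple = couple +
  assumes ex_cyclic_dualizing: "\<exists>d. cyclic lact ract d \<and> dualizing lact ract d"


section \<open>The quantale of sup-endomorphisms\<close>

typedef (overloaded) 'a sup_end = "{f :: 'a::complete_lattice \<Rightarrow> 'a. sup_hom f}"
  morphisms app Abs_sup_end
  by (rule exI[of _ id]) (simp add: sup_hom_def)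

setup_lifting type_definition_sup_end

lemma sup_hom_SUP:
  assumes "\<And>f. f \<in> F \<Longrightarrow> sup_hom f" shows "sup_hom (\<lambda>x. SUP f\<in>F. f x)"
  unfolding sup_hom_def
proof
  fix A
  have "(SUP f\<in>F. f (Sup A)) = (SUP f\<in>F. SUP x\<in>A. f x)"
    using assms by (intro SUP_cong refl) (simp add: sup_hom_Sup)
  also have "\<dots> = (SUP x\<in>A. SUP f\<in>F. f x)" by (rule SUP_commute)
  finally show "(SUP f\<in>F. f (Sup A)) = (SUP x\<in>A. SUP f\<in>F. f x)" .
qed

instantiation sup_end :: (complete_lattice) complete_lattice
begin

lift_definition less_eq_sup_end :: "'a sup_end \<Rightarrow> 'a sup_end \<Rightarrow> bool"
  is "\<lambda>f g. \<forall>x. f x \<le> g x" .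
definition less_sup_end :: "'a sup_end \<Rightarrow> 'a sup_end \<Rightarrow> bool" where
  "less_sup_end f g \<longleftrightarrow> f \<le> g \<and> \<not> g \<le> f"
lift_definition Sup_sup_end :: "'a sup_end set \<Rightarrow> 'a sup_end"
  is "\<lambda>F x. SUP f\<in>F. f x"
  by (rule sup_hom_SUP) auto
definition Inf_sup_end :: "'a sup_end set \<Rightarrow> 'a sup_end" where
  "Inf_sup_end F = Sup {f. \<forall>g\<in>F. f \<le> g}"
definition inf_sup_end :: "'a sup_end \<Rightarrow> 'a sup_end \<Rightarrow> 'a sup_end" where
  "inf_sup_end f g = Inf {f, g}"
definition sup_sup_end :: "'a sup_end \<Rightarrow> 'a sup_end \<Rightarrow> 'a sup_end" where
  "sup_sup_end f g = Sup {f, g}"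
definition bot_sup_end :: "'a sup_end" where "bot_sup_end = Sup {}"
definition top_sup_end :: "'a sup_end" where "top_sup_end = Inf {}"

instance
proof
  fix x y z :: "'a sup_end" and A :: "'a sup_end set"
  show "(x < y) = (x \<le> y \<and> \<not> y \<le> x)" by (rule less_sup_end_def)
  have le: "f \<le> g \<longleftrightarrow> (\<forall>z. app f z \<le> app g z)" for f g :: "'a sup_end"
    by (rule less_eq_sup_end.rep_eq)
  show "x \<le> x" by (simp add: le)
  show "x \<le> y \<Longrightarrow> y \<le> z \<Longrightarrow> x \<le> z" unfolding le by (meson order.trans)
  show "x \<le> y \<Longrightarrow> y \<le> x \<Longrightarrow> x = y"
    by (simp add: le app_inject[symmetric] fun_eq_iff order.antisym)
  have Sup1: "b \<le> Sup B" if "b \<in> B" for b and B :: "'a sup_end set"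
    using that by (auto simp: less_eq_sup_end.rep_eq Sup_sup_end.rep_eq image_image intro: SUP_upper)
  have Sup2: "Sup B \<le> b" if "\<And>w. w \<in> B \<Longrightarrow> w \<le> b" for b and B :: "'a sup_end set"
    using that
    by (auto simp: less_eq_sup_end.rep_eq Sup_sup_end.rep_eq image_image intro!: SUP_least)
  have Inf1: "Inf B \<le> b" if "b \<in> B" for b and B :: "'a sup_end set"
    unfolding Inf_sup_end_def using that by (intro Sup2) auto
  have Inf2: "b \<le> Inf B" if "\<And>w. w \<in> B \<Longrightarrow> b \<le> w" for b and B :: "'a sup_end set"
    unfolding Inf_sup_end_def using that by (intro Sup1) auto
  show "inf x y \<le> x" "inf x y \<le> y" unfolding inf_sup_end_def by (auto intro: Inf1)
  show "x \<le> y \<Longrightarrow> x \<le> z \<Longrightarrow> x \<le> inf y z" unfolding inf_sup_end_def by (auto intro: Inf2)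
  show "x \<le> sup x y" "y \<le> sup x y" unfolding sup_sup_end_def by (auto intro: Sup1)
  show "y \<le> x \<Longrightarrow> z \<le> x \<Longrightarrow> sup y z \<le> x" unfolding sup_sup_end_def by (auto intro: Sup2)
  show "x \<in> A \<Longrightarrow> Inf A \<le> x" by (rule Inf1)
  show "(\<And>x. x \<in> A \<Longrightarrow> z \<le> x) \<Longrightarrow> z \<le> Inf A" by (rule Inf2)
  show "x \<in> A \<Longrightarrow> x \<le> Sup A" by (rule Sup1)
  show "(\<And>x. x \<in> A \<Longrightarrow> x \<le> z) \<Longrightarrow> Sup A \<le> z" by (rule Sup2)
  show "Inf {} = (top :: 'a sup_end)" by (simp add: top_sup_end_def)
  show "Sup {} = (bot :: 'a sup_end)" by (simp add: bot_sup_end_def)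
qed

end

lift_definition comp_end :: "'a::complete_lattice sup_end \<Rightarrow> 'a sup_end \<Rightarrow> 'a sup_end"
  is "\<lambda>f g. f \<circ> g"
proof -
  fix f g :: "'a \<Rightarrow> 'a" assume f: "sup_hom f" and g: "sup_hom g"
  show "sup_hom (f \<circ> g)"
    unfolding sup_hom_def o_apply sup_hom_Sup[OF g] sup_hom_Sup[OF f] by (simp add: image_comp)
qed

lemma sup_hom_rho:
  "sup_hom (\<lambda>y :: 'a::complete_lattice. if y \<noteq> bot then x else bot :: 'b::complete_lattice)"
  (is "sup_hom ?r")
  unfolding sup_hom_def
proof
  fix A :: "'a set"
  show "?r (Sup A) = Sup (?r ` A)"
  proof (rule order.antisym)
    show "?r (Sup A) \<le> Sup (?r ` A)"
    proof (cases "\<exists>a\<in>A. a \<noteq> bot")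
      case True
      then obtain a where a: "a \<in> A" "a \<noteq> bot" by blast
      have "?r (Sup A) \<le> ?r a" using a(2) by simp
      also have "\<dots> \<le> Sup (?r ` A)" using a(1) by (rule SUP_upper)
      finally show ?thesis .
    next
      case False
      then have "Sup A \<le> bot" by (intro Sup_least) (metis order.refl)
      then have "Sup A = bot" by (rule bot_unique[THEN iffD1])
      then show ?thesis by simp
    qed
    show "Sup (?r ` A) \<le> ?r (Sup A)"
    proof (rule SUP_least)
      fix a assume "a \<in> A"
      then have "a \<le> Sup A" by (rule Sup_upper)
      then show "?r a \<le> ?r (Sup A)" by (cases "Sup A = bot") (simp_all add: bot_unique)
    qed
  qed
qed

lemma sup_hom_lam:
  "sup_hom (\<lambda>y :: 'a::complete_lattice. if y \<le> x then bot else top :: 'b::complete_lattice)"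
  (is "sup_hom ?l")
  unfolding sup_hom_def
proof
  fix A :: "'a set"
  show "?l (Sup A) = Sup (?l ` A)"
  proof (rule order.antisym)
    show "?l (Sup A) \<le> Sup (?l ` A)"
    proof (cases "\<exists>a\<in>A. \<not> a \<le> x")
      case True
      then obtain a where a: "a \<in> A" "\<not> a \<le> x" by blast
      have "?l (Sup A) \<le> ?l a" using a(2) by simp
      also have "\<dots> \<le> Sup (?l ` A)" using a(1) by (rule SUP_upper)
      finally show ?thesis .
    next
      case False
      then have "Sup A \<le> x" by (intro Sup_least) simp
      then show ?thesis by simp
    qed
    show "Sup (?l ` A) \<le> ?l (Sup A)"
    proof (rule SUP_least)
      fix a assume "a \<in> A"
      then have "a \<le> Sup A" by (rule Sup_upper)
      then show "?l a \<le> ?l (Sup A)" using order.trans[of a "Sup A" x] by simp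
    qed
  qed
qed

lift_definition rho :: "'a::complete_lattice \<Rightarrow> 'a sup_end"
  is "\<lambda>x y. if y \<noteq> bot then x else bot"
  by (rule sup_hom_rho)

lift_definition lam :: "'a::complete_lattice \<Rightarrow> 'a sup_end"
  is "\<lambda>x y. if y \<le> x then bot else top"
  by (rule sup_hom_lam)


section \<open>The data of the couple on generators\<close>

text \<open>Each of the following predicates says that a map (or pair of actions) has the required
  structure and extends the given assignment on generators; that exactly one such extension exists
  is part of the theorem, not of the definitions.\<close>

type_synonym 'a csup = "('a, 'a dual) tensor"

definition csup_mult :: "('a::complete_lattice csup \<Rightarrow> 'a csup \<Rightarrow> 'a csup) \<Rightarrow> bool" where
  "csup_mult mult \<longleftrightarrow> quantale mult \<and>
     (\<forall>x y u v. mult (x \<otimes> dual y) (u \<otimes> dual v) = (if u \<le> y then bot else x \<otimes> dual v))"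

definition csup_bimodule ::
  "('a::complete_lattice sup_end \<Rightarrow> 'a csup \<Rightarrow> 'a csup) \<Rightarrow>
   ('a csup \<Rightarrow> 'a sup_end \<Rightarrow> 'a csup) \<Rightarrow> bool" where
  "csup_bimodule lact ract \<longleftrightarrow> bimodule comp_end lact ract \<and>
     (\<forall>\<alpha> x y. lact \<alpha> (x \<otimes> dual y) = app \<alpha> x \<otimes> dual y) \<and>
     (\<forall>x y \<alpha>. ract (x \<otimes> dual y) \<alpha> = x \<otimes> dual (right_adjoint (app \<alpha>) y))"

definition csup_phi :: "('a::complete_lattice csup \<Rightarrow> 'a sup_end) \<Rightarrow> bool" where
  "csup_phi \<phi> \<longleftrightarrow> sup_hom \<phi> \<and> (\<forall>x y. \<phi> (x \<otimes> dual y) = comp_end (rho x) (lam y))"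

definition csup_d :: "'a::complete_lattice csup" where
  "csup_d = (SUP x. x \<otimes> dual x)"

end

theory Submission
  imports Defs
begin

text \<open>
  An element \<open>c\<close> of \<open>S \<otimes> S\<^sup>o\<^sup>p\<close> amounts to the sup-endomorphism \<open>\<alpha>\<close> with
  \<open>\<alpha>(x) \<le> y\<close> iff \<open>x \<otimes> y' \<le> c\<close>. This is an order-reversing bijection between \<open>S \<otimes> S\<^sup>o\<^sup>p\<close> and
  \<open>\<Q>(S)\<close>, under which \<open>d\<close> corresponds to the identity. By adjointness, \<open>\<alpha>c \<le> d\<close> and \<open>c\<alpha> \<le> d\<close>
  both say that \<open>\<alpha>(x) \<le> y\<close> whenever \<open>x \<otimes> y' \<le> c\<close>, so \<open>d\<close> is cyclic and all residuals into \<open>d\<close>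
  are given by the bijection; hence \<open>d\<close> is dualizing. The multiplication is \<open>ab = \<phi>(a)b\<close>, and its
  associativity follows from \<open>\<phi>\<close> being a homomorphism of left modules.
\<close>

section \<open>Sup-homomorphisms on tensor products\<close>

lemma sup_hom_compose:
  assumes "sup_hom f" "sup_hom g" shows "sup_hom (\<lambda>x. f (g x))"
  using assms by (simp add: sup_hom_def image_image)

lemma sup_hom_tensor_gen_left: "sup_hom (\<lambda>s. s \<otimes> t)"
  by (simp add: sup_hom_def Sup_tensor_gen)

lemma sup_hom_tensor_gen_right: "sup_hom (\<lambda>t. s \<otimes> t)"
  by (simp add: sup_hom_def tensor_gen_Sup)

text \<open>Every u is the join of the generators below it, and f preserves that join. Both equality
  of homomorphisms and inequalities into \<open>csup_d\<close> are reduced to generators this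
  way.\<close>

lemma tensor_hom_le_iff:
  assumes f: "sup_hom f"
  shows "f u \<le> z \<longleftrightarrow> (\<forall>s t. s \<otimes> t \<le> u \<longrightarrow> f (s \<otimes> t) \<le> z)"
proof
  assume "f u \<le> z"
  then show "\<forall>s t. s \<otimes> t \<le> u \<longrightarrow> f (s \<otimes> t) \<le> z"
    using sup_hom_mono[OF f] order.trans by blast
next
  assume *: "\<forall>s t. s \<otimes> t \<le> u \<longrightarrow> f (s \<otimes> t) \<le> z"
  have "f (Sup {s \<otimes> t |s t. s \<otimes> t \<le> u}) \<le> z"
    unfolding sup_hom_Sup[OF f] by (rule SUP_least) (use * in blast)
  then show "f u \<le> z" by (simp only: tensor_eq_Sup_gens[symmetric])
qed

lemma tensor_hom_eqI:
  assumes f: "sup_hom f" and g: "sup_hom g" and gen: "\<And>s t. f (s \<otimes> t) = g (s \<otimes> t)"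
  shows "f u = g u"
proof (rule order.antisym)
  show "f u \<le> g u" unfolding tensor_hom_le_iff[OF f, of u] gen using sup_hom_mono[OF g] by blast
  show "g u \<le> f u" unfolding tensor_hom_le_iff[OF g, of u] gen[symmetric]
    using sup_hom_mono[OF f] by blast
qed

lemma tensor_bihom_eqI:
  assumes "\<And>v. sup_hom (\<lambda>u. f u v)" "\<And>u. sup_hom (\<lambda>v. f u v)"
    and "\<And>v. sup_hom (\<lambda>u. g u v)" "\<And>u. sup_hom (\<lambda>v. g u v)"
    and gen: "\<And>s t p q. f (s \<otimes> t) (p \<otimes> q) = g (s \<otimes> t) (p \<otimes> q)"
  shows "f u v = g u v"
proof -
  have "f (s \<otimes> t) v = g (s \<otimes> t) v" for s t
    by (rule tensor_hom_eqI[OF assms(2) assms(4) gen])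
  then show ?thesis by (rule tensor_hom_eqI[OF assms(1) assms(3)])
qed

text \<open>A pointwise join of sup-homomorphisms is one again, so \<open>h (Sup A)\<close> and the
  join of the \<open>h a\<close> need only agree on generators. Both actions get join preservation
  in the endomorphism variable from this.\<close>

lemma tensor_hom_sup_hom_param:
  assumes h: "\<And>a. sup_hom (h a)" and gen: "\<And>s t. sup_hom (\<lambda>a. h a (s \<otimes> t))"
  shows "sup_hom (\<lambda>a. h a u)"
  unfolding sup_hom_def
proof
  fix A
  have "sup_hom (\<lambda>u. SUP f\<in>h ` A. f u)" by (rule sup_hom_SUP) (use h in auto)
  then have "sup_hom (\<lambda>u. SUP a\<in>A. h a u)" by (simp add: image_image)
  from h this show "h (Sup A) u = (SUP a\<in>A. h a u)"
    by (rule tensor_hom_eqI) (rule sup_hom_Sup[OF gen])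
qed

text \<open>Meaningful when f preserves joins in each variable: \<open>tensor_universal\<close> then
  provides the unique extension.\<close>

definition tensor_lift ::
  "('a::complete_lattice \<Rightarrow> 'b::complete_lattice \<Rightarrow> 'c::complete_lattice) \<Rightarrow> ('a, 'b) tensor \<Rightarrow> 'c"
  where "tensor_lift f = (THE g. sup_hom g \<and> (\<forall>s t. g (s \<otimes> t) = f s t))"

lemma
  assumes "\<And>t. sup_hom (\<lambda>s. f s t)" and "\<And>s. sup_hom (\<lambda>t. f s t)"
  shows sup_hom_tensor_lift: "sup_hom (tensor_lift f)"
    and tensor_lift_gen: "tensor_lift f (s \<otimes> t) = f s t"
  using theI'[OF tensor_universal[of f, OF assms]] by (auto simp: tensor_lift_def)

lemma all_dual_iff: "(\<forall>t. P t) \<longleftrightarrow> (\<forall>y. P (dual y))"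
  by (metis dual_undual)

lemma csup_hom_eqI:
  fixes u :: "'a::complete_lattice csup"
  assumes "sup_hom f" "sup_hom g" "\<And>x y. f (x \<otimes> dual y) = g (x \<otimes> dual y)"
  shows "f u = g u"
  using assms(1,2) 
proof (rule tensor_hom_eqI)
  show "f (s \<otimes> t) = g (s \<otimes> t)" for s t using assms(3)[of s "undual t"] by simp
qed

lemma csup_bihom_eqI:
  fixes c e :: "'a::complete_lattice csup"
  assumes "\<And>e. sup_hom (\<lambda>c. f c e)" "\<And>c. sup_hom (\<lambda>e. f c e)"
    and "\<And>e. sup_hom (\<lambda>c. g c e)" "\<And>c. sup_hom (\<lambda>e. g c e)"
    and "\<And>x y u v. f (x \<otimes> dual y) (u \<otimes> dual v) = g (x \<otimes> dual y) (u \<otimes> dual v)"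
  shows "f c e = g c e"
  using assms(1-4)
proof (rule tensor_bihom_eqI)
  show "f (s \<otimes> t) (p \<otimes> q) = g (s \<otimes> t) (p \<otimes> q)" for s t p q
    using assms(5)[of s "undual t" p "undual q"] by simp
qed

lemma csup_hom_le_iff:
  fixes c :: "'a::complete_lattice csup"
  assumes "sup_hom f"
  shows "f c \<le> z \<longleftrightarrow> (\<forall>x y. x \<otimes> dual y \<le> c \<longrightarrow> f (x \<otimes> dual y) \<le> z)"
  unfolding tensor_hom_le_iff[OF assms, of c] by (simp only: all_dual_iff)

text \<open>\<open>dual top\<close> is the bottom of the opposite lattice, that is, an empty
  join.\<close>

lemma tensor_gen_dual_top: "x \<otimes> dual top = bot"
  using sup_hom_Sup[OF sup_hom_tensor_gen_right, of x "{} :: 'b dual set"] by simp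

lemma bot_tensor_gen: "bot \<otimes> t = bot"
  using sup_hom_Sup[OF sup_hom_tensor_gen_left, where A = "{}"] by simp

section \<open>Sup-endomorphisms\<close>

lemma sup_hom_app: "sup_hom (app \<alpha>)"
  using app[of \<alpha>] by simp

lemma sup_end_eqI: "(\<And>x. app \<alpha> x = app \<beta> x) \<Longrightarrow> \<alpha> = \<beta>"
  by (simp add: app_inject[symmetric] fun_eq_iff)

lemma app_Sup: "app (Sup A) x = (SUP \<alpha>\<in>A. app \<alpha> x)"
  by (simp add: Sup_sup_end.rep_eq image_image)

lemma app_comp_end [simp]: "app (comp_end \<alpha> \<beta>) x = app \<alpha> (app \<beta> x)"
  by (simp add: comp_end.rep_eq)

lemma app_bot [simp]: "app \<alpha> bot = bot"
  using sup_hom_Sup[OF sup_hom_app, of \<alpha> "{}"] by simp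

lemma sup_hom_app_left: "sup_hom (\<lambda>\<alpha>. app \<alpha> x)"
  by (simp add: sup_hom_def app_Sup)

lemma sup_end_sup_homI:
  assumes "\<And>x. sup_hom (\<lambda>a. app (f a) x)" shows "sup_hom f"
  unfolding sup_hom_def
  by (intro allI sup_end_eqI) (simp add: app_Sup image_image sup_hom_Sup[OF assms])

lemma quantale_comp_end: "quantale comp_end"
proof
  show "comp_end (comp_end \<alpha> \<beta>) \<gamma> = comp_end \<alpha> (comp_end \<beta> \<gamma>)" for \<alpha> \<beta> \<gamma> :: "'a sup_end"
    by (rule sup_end_eqI) simp
  show "sup_hom (\<lambda>\<alpha>. comp_end \<alpha> \<beta>)" for \<beta> :: "'a sup_end"
    by (rule sup_end_sup_homI) (simp add: sup_hom_app_left)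
  show "sup_hom (\<lambda>\<beta>. comp_end \<alpha> \<beta>)" for \<alpha> :: "'a sup_end"
    by (rule sup_end_sup_homI) (simp add: sup_hom_compose[OF sup_hom_app sup_hom_app_left])
qed

section \<open>Right adjoints of sup-endomorphisms\<close>

lemma le_right_adjoint_iff: "s \<le> right_adjoint (app \<alpha>) y \<longleftrightarrow> app \<alpha> s \<le> y"
  using right_adjoint_iff[OF sup_hom_app] by blast

lemma eqI_lower_set:
  fixes x :: "'a::order"
  assumes "\<And>s. s \<le> x \<longleftrightarrow> s \<le> y" shows "x = y"
  using assms by (meson order.antisym order.refl)

lemma eqI_upper_set:
  fixes x :: "'a::order"
  assumes "\<And>s. x \<le> s \<longleftrightarrow> y \<le> s" shows "x = y"
  using assms by (meson order.antisym order.refl)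

lemma right_adjoint_app_comp_end:
  "right_adjoint (app (comp_end \<alpha> \<beta>)) y = right_adjoint (app \<beta>) (right_adjoint (app \<alpha>) y)"
  by (rule eqI_lower_set) (simp add: le_right_adjoint_iff)

text \<open>The right adjoint of a join of maps is the meet of their right adjoints, and
  \<open>dual\<close> turns this meet into a join.\<close>

lemma sup_hom_dual_right_adjoint: "sup_hom (\<lambda>\<alpha>. dual (right_adjoint (app \<alpha>) y))"
proof -
  have "right_adjoint (app (Sup A)) y = (INF \<alpha>\<in>A. right_adjoint (app \<alpha>) y)" for A
    by (rule eqI_lower_set) (simp add: le_right_adjoint_iff app_Sup SUP_le_iff le_INF_iff)
  then show ?thesis by (simp add: sup_hom_def image_image)
qed

text \<open>Right adjoints preserve meets, hence act as sup-homomorphisms on the opposite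
  lattice.\<close>

lemma sup_hom_dual_right_adjoint_undual:
  "sup_hom (\<lambda>t. dual (right_adjoint (app \<alpha>) (undual t)))"
proof -
  have "right_adjoint (app \<alpha>) (undual (Sup A)) = (INF t\<in>A. right_adjoint (app \<alpha>) (undual t))" for A
    by (rule eqI_lower_set) (simp add: le_right_adjoint_iff le_INF_iff)
  then show ?thesis unfolding sup_hom_def by (simp add: image_image del: undual_Sup_eq)
qed

section \<open>The endomorphisms \<open>rho x\<close> after \<open>lam y\<close>\<close>

lemma app_rho_lam [simp]:
  fixes x :: "'a::complete_lattice"
  shows "app (comp_end (rho x) (lam y)) u = (if u \<le> y then bot else x)"
proof -
  \<comment> \<open>\<open>rho x\<close> takes top to x by definition only if top differs from bot;
    in the one-element lattice this still holds because x is bot.\<close>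
  have "x = bot" if "(top :: 'a) = bot" using top_greatest[of x] that by (simp add: bot_unique)
  then show ?thesis by (auto simp: rho.rep_eq lam.rep_eq)
qed

lemma comp_end_rho_lam: "comp_end \<alpha> (comp_end (rho x) (lam y)) = comp_end (rho (app \<alpha> x)) (lam y)"
  by (rule sup_end_eqI) (simp add: app_comp_end[of \<alpha>] del: app_comp_end)

lemma rho_lam_comp_end:
  "comp_end (comp_end (rho x) (lam y)) \<alpha> = comp_end (rho x) (lam (right_adjoint (app \<alpha>) y))"
  by (rule sup_end_eqI)
    (simp add: app_comp_end[of _ \<alpha>] le_right_adjoint_iff del: app_comp_end)

lemma right_adjoint_rho_lam:
  "right_adjoint (app (comp_end (rho u) (lam v))) y = (if u \<le> y then top else v)"
  by (rule eqI_lower_set) (auto simp: le_right_adjoint_iff simp del: app_comp_end)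

section \<open>Existence and uniqueness of the structure\<close>

lemma ex1_csup_phi: "\<exists>!\<phi> :: 'a::complete_lattice csup \<Rightarrow> 'a sup_end. csup_phi \<phi>"
proof -
  let ?f = "\<lambda>(x::'a) t. comp_end (rho x) (lam (undual t))"
  \<comment> \<open>Values are compared through their upper bounds z. A join in x or a meet in y
    affects only one side of this disjunction and so passes through it.\<close>
  have le: "app (comp_end (rho x) (lam y)) u \<le> z \<longleftrightarrow> u \<le> y \<or> x \<le> z" for x y u z :: 'a
    by (simp del: app_comp_end)
  have "sup_hom (\<lambda>x. ?f x t)" for t
    by (rule sup_end_sup_homI, unfold sup_hom_def, rule allI, rule eqI_upper_set)
      (auto simp: le SUP_le_iff Sup_le_iff simp del: app_comp_end app_rho_lam)
  moreover have "sup_hom (?f x)" for x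
    by (rule sup_end_sup_homI, unfold sup_hom_def, rule allI, rule eqI_upper_set)
      (auto simp: le SUP_le_iff le_INF_iff simp del: app_comp_end app_rho_lam)
  ultimately have "\<exists>!\<phi>. sup_hom \<phi> \<and> (\<forall>x t. \<phi> (x \<otimes> t) = ?f x t)" by (rule tensor_universal)
  moreover have "(\<forall>x t. \<phi> (x \<otimes> t) = ?f x t) \<longleftrightarrow> (\<forall>x y. \<phi> (x \<otimes> dual y) = comp_end (rho x) (lam y))"
    for \<phi> :: "'a csup \<Rightarrow> 'a sup_end"
    by (metis dual_undual undual_dual)
  ultimately show ?thesis by (simp add: csup_phi_def)
qed

lemma csup_bimodule_unique:
  assumes "csup_bimodule lact ract" "csup_bimodule lact' ract'"
  shows "lact = lact'" "ract = ract'"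
proof -
  interpret A: bimodule comp_end lact ract using assms(1) by (simp add: csup_bimodule_def)
  interpret B: bimodule comp_end lact' ract' using assms(2) by (simp add: csup_bimodule_def)
  have "lact \<alpha> c = lact' \<alpha> c" for \<alpha> c
    using A.lact_sup_hom_right B.lact_sup_hom_right
    by (rule csup_hom_eqI) (use assms in \<open>simp add: csup_bimodule_def\<close>)
  then show "lact = lact'" by (intro ext)
  have "ract c \<alpha> = ract' c \<alpha>" for \<alpha> c
    using A.ract_sup_hom_left B.ract_sup_hom_left
    by (rule csup_hom_eqI) (use assms in \<open>simp add: csup_bimodule_def\<close>)
  then show "ract = ract'" by (intro ext)
qed

lemma ex_csup_bimodule: "\<exists>lact ract. csup_bimodule (lact :: 'a::complete_lattice sup_end \<Rightarrow> _) ract"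
proof -
  define lact :: "'a sup_end \<Rightarrow> 'a csup \<Rightarrow> 'a csup"
    where "lact \<alpha> = tensor_lift (\<lambda>x t. app \<alpha> x \<otimes> t)" for \<alpha>
  define ract :: "'a csup \<Rightarrow> 'a sup_end \<Rightarrow> 'a csup"
    where "ract c \<alpha> = tensor_lift (\<lambda>x t. x \<otimes> dual (right_adjoint (app \<alpha>) (undual t))) c" for c \<alpha>
  have homl: "sup_hom (\<lambda>x. app \<alpha> x \<otimes> t)" for \<alpha> :: "'a sup_end" and t :: "'a dual"
    by (rule sup_hom_compose[OF sup_hom_tensor_gen_left sup_hom_app])
  have homr: "sup_hom (\<lambda>t. x \<otimes> dual (right_adjoint (app \<alpha>) (undual t)))"
    for \<alpha> :: "'a sup_end" and x :: 'a
    by (rule sup_hom_compose[OF sup_hom_tensor_gen_right sup_hom_dual_right_adjoint_undual])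
  have lact_hom: "sup_hom (lact \<alpha>)" and lact: "lact \<alpha> (x \<otimes> t) = app \<alpha> x \<otimes> t" for \<alpha> x t
    using sup_hom_tensor_lift[OF homl sup_hom_tensor_gen_right, of \<alpha>]
      tensor_lift_gen[OF homl sup_hom_tensor_gen_right, of \<alpha>] by (simp_all add: lact_def)
  have ract_hom: "sup_hom (\<lambda>c. ract c \<alpha>)"
    and ract: "ract (x \<otimes> t) \<alpha> = x \<otimes> dual (right_adjoint (app \<alpha>) (undual t))" for \<alpha> x t
    using sup_hom_tensor_lift[OF sup_hom_tensor_gen_left homr, of \<alpha>]
      tensor_lift_gen[OF sup_hom_tensor_gen_left homr, of \<alpha>] by (simp_all add: ract_def)
  have "bimodule comp_end lact ract"
  proof (intro bimodule.intro quantale_comp_end bimodule_axioms.intro)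
    fix a b m
    show "sup_hom (\<lambda>a. lact a m)"
      using lact_hom by (rule tensor_hom_sup_hom_param)
        (simp add: lact sup_hom_compose[OF sup_hom_tensor_gen_left sup_hom_app_left])
    show "sup_hom (lact a)" by (rule lact_hom)
    show "sup_hom (\<lambda>m. ract m a)" by (rule ract_hom)
    show "sup_hom (ract m)"
      using tensor_hom_sup_hom_param[of "\<lambda>a c. ract c a", OF ract_hom]
      by (simp add: ract sup_hom_compose[OF sup_hom_tensor_gen_right sup_hom_dual_right_adjoint])
    show "lact (comp_end a b) m = lact a (lact b m)"
      using lact_hom sup_hom_compose[OF lact_hom lact_hom]
      by (rule tensor_hom_eqI) (simp add: lact)
    show "ract m (comp_end a b) = ract (ract m a) b"
      using ract_hom sup_hom_compose[OF ract_hom ract_hom]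
      by (rule tensor_hom_eqI) (simp add: ract right_adjoint_app_comp_end)
    show "ract (lact a m) b = lact a (ract m b)"
      using sup_hom_compose[OF ract_hom lact_hom] sup_hom_compose[OF lact_hom ract_hom]
      by (rule tensor_hom_eqI) (simp add: ract lact)
  qed
  then have "csup_bimodule lact ract" by (simp add: csup_bimodule_def lact ract)
  then show ?thesis by blast
qed

lemma csup_mult_unique:
  assumes "csup_mult mult" "csup_mult mult'" shows "mult = mult'"
proof (intro ext)
  interpret A: quantale mult using assms(1) by (simp add: csup_mult_def)
  interpret B: quantale mult' using assms(2) by (simp add: csup_mult_def)
  show "mult a b = mult' a b" for a b
    using A.mult_sup_hom_left A.mult_sup_hom_right B.mult_sup_hom_left B.mult_sup_hom_right
    by (rule csup_bihom_eqI) (use assms in \<open>simp add: csup_mult_def\<close>)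
qed

section \<open>The couple\<close>

text \<open>The multiplication is not fixed here: it is recovered from the left action and
  \<phi>.\<close>

locale csup_data =
  fixes lact :: "'a::complete_lattice sup_end \<Rightarrow> 'a csup \<Rightarrow> 'a csup"
    and ract :: "'a csup \<Rightarrow> 'a sup_end \<Rightarrow> 'a csup"
    and \<phi> :: "'a csup \<Rightarrow> 'a sup_end"
  assumes csup_bimodule: "csup_bimodule lact ract" and csup_phi: "csup_phi \<phi>"
begin

sublocale bimodule comp_end lact ract
  using csup_bimodule by (simp add: csup_bimodule_def)

lemma lact_gen: "lact \<alpha> (x \<otimes> dual y) = app \<alpha> x \<otimes> dual y"
  and ract_gen: "ract (x \<otimes> dual y) \<alpha> = x \<otimes> dual (right_adjoint (app \<alpha>) y)"
  using csup_bimodule by (simp_all add: csup_bimodule_def)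

lemma phi_sup_hom: "sup_hom \<phi>" and phi_gen: "\<phi> (x \<otimes> dual y) = comp_end (rho x) (lam y)"
  using csup_phi by (simp_all add: csup_phi_def)

lemma phi_lact: "\<phi> (lact \<alpha> c) = comp_end \<alpha> (\<phi> c)"
  using sup_hom_compose[OF phi_sup_hom lact_sup_hom_right]
    sup_hom_compose[OF mult_sup_hom_right phi_sup_hom]
  by (rule csup_hom_eqI) (simp add: lact_gen phi_gen comp_end_rho_lam)

text \<open>Since \<alpha>(u) \<le> y iff u lies below the right adjoint at y, \<open>lam y\<close>
  after \<alpha> is the \<open>lam\<close> that the right action prescribes on generators.\<close>

lemma phi_ract: "\<phi> (ract c \<alpha>) = comp_end (\<phi> c) \<alpha>"
  using sup_hom_compose[OF phi_sup_hom ract_sup_hom_left]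
    sup_hom_compose[OF mult_sup_hom_left phi_sup_hom]
  by (rule csup_hom_eqI) (simp add: ract_gen phi_gen rho_lam_comp_end)

lemma bimodule_hom_phi: "bimodule_hom lact ract comp_end comp_end \<phi>"
  by (simp add: bimodule_hom_def phi_sup_hom phi_lact phi_ract)

text \<open>The witness for the multiplication. On generators the left factor acts on u, giving 0 if
  u \<le> y and x otherwise, and v' is kept.\<close>

lemma csup_mult_lact_phi: "csup_mult (\<lambda>a b. lact (\<phi> a) b)"
proof -
  have "quantale (\<lambda>a b. lact (\<phi> a) b)"
    by standard (simp_all add: phi_lact lact_mult lact_sup_hom_right
        sup_hom_compose[OF lact_sup_hom_left phi_sup_hom])
  then show ?thesis
    by (simp add: csup_mult_def phi_gen lact_gen bot_tensor_gen del: app_comp_end)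
qed

text \<open>On generators, if u \<le> y then the left side is x \<otimes> 1' = 0 and the right side
  is 0 \<otimes> v' = 0; otherwise both are x \<otimes> v'.\<close>

lemma ract_phi_eq: "ract a (\<phi> b) = lact (\<phi> a) b"
proof (rule csup_bihom_eqI[where f = "\<lambda>a b. ract a (\<phi> b)" and g = "\<lambda>a b. lact (\<phi> a) b"])
  show "sup_hom (\<lambda>a. ract a (\<phi> b))" for b by (rule ract_sup_hom_left)
  show "sup_hom (\<lambda>b. ract a (\<phi> b))" for a
    by (rule sup_hom_compose[OF ract_sup_hom_right phi_sup_hom])
  show "sup_hom (\<lambda>a. lact (\<phi> a) b)" for b
    by (rule sup_hom_compose[OF lact_sup_hom_left phi_sup_hom])
  show "sup_hom (\<lambda>b. lact (\<phi> a) b)" for a by (rule lact_sup_hom_right)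
qed (simp add: phi_gen lact_gen ract_gen right_adjoint_rho_lam bot_tensor_gen tensor_gen_dual_top
    del: app_comp_end dual_top_eq)

text \<open>The image of the single generator 1 \<otimes> 0' is already the greatest endomorphism:
  it takes every nonzero u to 1, and every endomorphism fixes 0.\<close>

lemma phi_top: "\<phi> top = top"
proof (rule order.antisym[OF top_greatest])
  have "app top u \<le> app (\<phi> (top \<otimes> dual bot)) u" for u
    by (cases "u = bot") (simp_all add: phi_gen bot_unique del: app_comp_end dual_bot_eq)
  then have "top \<le> \<phi> (top \<otimes> dual bot)" by (simp add: less_eq_sup_end.rep_eq)
  also have "\<dots> \<le> \<phi> top" by (rule sup_hom_mono[OF phi_sup_hom top_greatest])
  finally show "top \<le> \<phi> top" .
qed

lemma strong_couple:
  assumes "csup_mult mult" shows "strong_couple mult comp_end lact ract \<phi>"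
proof -
  \<comment> \<open>By uniqueness, any admissible multiplication is ab = \<phi>(a)b, so one couple
    identity is trivial and the other is \<open>ract_phi_eq\<close>.\<close>
  have "mult = (\<lambda>a b. lact (\<phi> a) b)" using assms csup_mult_lact_phi by (rule csup_mult_unique)
  moreover have "quantale mult" using assms by (simp add: csup_mult_def)
  ultimately show ?thesis
    by (intro strong_couple.intro couple.intro couple_axioms.intro strong_couple_axioms.intro
        bimodule_axioms bimodule_hom_phi quantale_comp_end phi_top)
      (simp_all add: ract_phi_eq)
qed

end

section \<open>The dualizing element\<close>

text \<open>One direction of the bijection. Closure in the first variable is join preservation of
  \<alpha>; in the second it holds because joins in the opposite lattice are meets in S.\<close>

lift_definition csup_of_end :: "'a::complete_lattice sup_end \<Rightarrow> 'a csup"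
  is "\<lambda>\<alpha>. {(x, t). \<alpha> x \<le> undual t}"
  by (auto simp: tensor_closed_def sup_hom_Sup SUP_le_iff le_INF_iff)

lemma gen_le_csup_of_end: "x \<otimes> dual y \<le> csup_of_end \<alpha> \<longleftrightarrow> app \<alpha> x \<le> y"
  by (simp add: tensor_gen_le_iff csup_of_end.rep_eq)

text \<open>For fixed x, the y with x \<otimes> y' \<le> c form an upper set that contains its meet,
  meets in S being joins in the opposite lattice.\<close>

lemma gen_le_csup_iff: "x \<otimes> dual y \<le> c \<longleftrightarrow> Inf {z. x \<otimes> dual z \<le> c} \<le> y"
proof
  assume *: "Inf {z. x \<otimes> dual z \<le> c} \<le> y"
  have "x \<otimes> dual (Inf {z. x \<otimes> dual z \<le> c}) \<le> c"
    by (simp add: tensor_gen_Sup_le_iff)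
  moreover have "x \<otimes> dual y \<le> x \<otimes> dual (Inf {z. x \<otimes> dual z \<le> c})"
    using * by (intro sup_hom_mono[OF sup_hom_tensor_gen_right]) (simp del: dual_Inf_eq)
  ultimately show "x \<otimes> dual y \<le> c" by (rule order.trans[rotated])
qed (simp add: Inf_lower)

lemma ex_csup_of_end: "\<exists>\<alpha>. c = csup_of_end \<alpha>"
proof -
  \<comment> \<open>The forced choice: \<alpha>(x) has to be the least y with x \<otimes> y' \<le>
    c.\<close>
  let ?f = "\<lambda>x. Inf {z. x \<otimes> dual z \<le> c}"
  have "sup_hom ?f"
    unfolding sup_hom_def
  proof
    fix A
    show "?f (Sup A) = Sup (?f ` A)"
      \<comment> \<open>The upper bounds of either side are the y with a \<otimes> y' \<le> c for
        all a in A.\<close>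
      by (rule eqI_upper_set, unfold SUP_le_iff gen_le_csup_iff[symmetric])
        (rule Sup_tensor_gen_le_iff)
  qed
  then have *: "x \<otimes> dual y \<le> c \<longleftrightarrow> x \<otimes> dual y \<le> csup_of_end (Abs_sup_end ?f)" for x y
    by (simp add: gen_le_csup_of_end Abs_sup_end_inverse gen_le_csup_iff[symmetric])
  have "x \<otimes> t \<le> c \<longleftrightarrow> x \<otimes> t \<le> csup_of_end (Abs_sup_end ?f)" for x t
    using *[of x "undual t"] by simp
  then have "c = csup_of_end (Abs_sup_end ?f)"
    by (intro order.antisym tensor_le_iff[THEN iffD2]) blast+
  then show ?thesis ..
qed

lemma le_csup_of_end_iff: "c \<le> csup_of_end \<alpha> \<longleftrightarrow> (\<forall>x y. x \<otimes> dual y \<le> c \<longrightarrow> app \<alpha> x \<le> y)"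
proof -
  have "sup_hom (\<lambda>c :: 'a csup. c)" by (simp add: sup_hom_def)
  then show ?thesis by (simp only: csup_hom_le_iff[of "\<lambda>c. c" c] gen_le_csup_of_end)
qed

lemma csup_of_end_antimono: "csup_of_end \<alpha> \<le> csup_of_end \<beta> \<longleftrightarrow> \<beta> \<le> \<alpha>"
proof -
  have "(\<forall>x y. app \<alpha> x \<le> y \<longrightarrow> app \<beta> x \<le> y) \<longleftrightarrow> (\<forall>x. app \<beta> x \<le> app \<alpha> x)"
    using order.trans by blast
  then show ?thesis
    unfolding less_eq_sup_end.rep_eq le_csup_of_end_iff[of "csup_of_end \<alpha>"] gen_le_csup_of_end .
qed

text \<open>All x \<otimes> x' lie below the element of the identity endomorphism, which gives one
  direction; the other is x \<otimes> y' \<le> y \<otimes> y', by monotonicity.\<close>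

lemma gen_le_csup_d: "x \<otimes> dual y \<le> csup_d \<longleftrightarrow> x \<le> y"
proof
  have id: "app (Abs_sup_end id) x = x" for x :: 'a
    by (simp add: Abs_sup_end_inverse sup_hom_def)
  have "csup_d \<le> csup_of_end (Abs_sup_end id :: 'a sup_end)"
    unfolding csup_d_def by (intro SUP_least) (simp add: gen_le_csup_of_end id)
  moreover assume "x \<otimes> dual y \<le> csup_d"
  ultimately have "x \<otimes> dual y \<le> csup_of_end (Abs_sup_end id)" by (rule order.trans[rotated])
  then show "x \<le> y" by (simp add: gen_le_csup_of_end id)
next
  assume "x \<le> y"
  then have "x \<otimes> dual y \<le> y \<otimes> dual y" by (rule sup_hom_mono[OF sup_hom_tensor_gen_left])
  also have "\<dots> \<le> csup_d" unfolding csup_d_def by (rule SUP_upper) simp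
  finally show "x \<otimes> dual y \<le> csup_d" .
qed

lemma Sup_lower_set: "Sup {x. x \<le> z} = (z :: 'b::complete_lattice)"
  by (rule Sup_eqI) auto

context csup_data
begin

text \<open>Tested on the generators x \<otimes> y' \<le> c, both sides read \<alpha>(x) \<le>
  y.\<close>

lemma lact_le_d_iff: "lact \<alpha> c \<le> csup_d \<longleftrightarrow> c \<le> csup_of_end \<alpha>"
  unfolding csup_hom_le_iff[OF lact_sup_hom_right, of \<alpha> c] le_csup_of_end_iff
    lact_gen gen_le_csup_d by (rule refl)

text \<open>Here the left side asks that x lie below the right adjoint at y, which is again
  \<alpha>(x) \<le> y.\<close>

lemma ract_le_d_iff: "ract c \<alpha> \<le> csup_d \<longleftrightarrow> c \<le> csup_of_end \<alpha>"
  unfolding csup_hom_le_iff[OF ract_sup_hom_left, of c \<alpha>] le_csup_of_end_iff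
    ract_gen gen_le_csup_d le_right_adjoint_iff by (rule refl)

lemma cyclic_csup_d: "cyclic lact ract csup_d"
  by (simp add: cyclic_def lact_le_d_iff ract_le_d_iff)

lemma dualizing_csup_d: "dualizing lact ract csup_d"
proof -
  \<comment> \<open>Each residual is the join of the principal lower set of
    \<open>csup_of_end \<alpha>\<close>.\<close>
  have into_C: "arrow\<^sub>Q ract \<alpha> csup_d = csup_of_end \<alpha>" "coarrow\<^sub>Q lact csup_d \<alpha> = csup_of_end \<alpha>" for \<alpha>
    by (simp_all add: arrow\<^sub>Q_def coarrow\<^sub>Q_def lact_le_d_iff ract_le_d_iff Sup_lower_set)
  \<comment> \<open>By order reversal, each of these is the join of the principal lower set of
    \<alpha>.\<close>
  have into_Q: "arrow\<^sub>C lact (csup_of_end \<alpha>) csup_d = \<alpha>" "coarrow\<^sub>C ract csup_d (csup_of_end \<alpha>) = \<alpha>"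
    for \<alpha>
    by (simp_all add: arrow\<^sub>C_def coarrow\<^sub>C_def lact_le_d_iff ract_le_d_iff csup_of_end_antimono
        Sup_lower_set)
  show ?thesis
    unfolding dualizing_def
  proof (intro conjI allI)
    fix c :: "'a csup"
    \<comment> \<open>Surjectivity of the bijection extends the identities to every c.\<close>
    obtain \<alpha> where c: "c = csup_of_end \<alpha>" using ex_csup_of_end by blast
    show "coarrow\<^sub>Q lact csup_d (arrow\<^sub>C lact c csup_d) = c"
      and "arrow\<^sub>Q ract (coarrow\<^sub>C ract csup_d c) csup_d = c"
      by (simp_all add: c into_C into_Q)
  qed (simp_all add: into_C into_Q)
qed

lemma girard_couple:
  assumes "csup_mult mult" shows "girard_couple mult comp_end lact ract \<phi>"
  using strong_couple[OF assms] cyclic_csup_d dualizing_csup_d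
  by (auto intro!: girard_couple.intro girard_couple_axioms.intro simp: strong_couple_def)

end

theorem theorem3p10:
  shows "(\<exists>!mult :: 'a::complete_lattice csup \<Rightarrow> 'a csup \<Rightarrow> 'a csup. csup_mult mult) \<and>
    (\<exists>!act :: ('a sup_end \<Rightarrow> 'a csup \<Rightarrow> 'a csup) \<times> ('a csup \<Rightarrow> 'a sup_end \<Rightarrow> 'a csup).
        csup_bimodule (fst act) (snd act)) \<and>
    (\<exists>!\<phi> :: 'a csup \<Rightarrow> 'a sup_end. csup_phi \<phi>) \<and>
    (\<forall>(mult :: 'a csup \<Rightarrow> 'a csup \<Rightarrow> 'a csup) lact ract \<phi>.
        csup_mult mult \<longrightarrow> csup_bimodule lact ract \<longrightarrow> csup_phi \<phi> \<longrightarrow>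
          strong_couple mult comp_end lact ract \<phi> \<and>
          girard_couple mult comp_end lact ract \<phi> \<and>
          cyclic lact ract (csup_d :: 'a csup) \<and>
          dualizing lact ract (csup_d :: 'a csup))"
proof (intro conjI allI impI)
  \<comment> \<open>Some actions and some \<phi> are needed to construct the multiplication.\<close>
  obtain lact :: "'a sup_end \<Rightarrow> 'a csup \<Rightarrow> 'a csup" and ract where bim: "csup_bimodule lact ract"
    using ex_csup_bimodule by blast
  obtain \<phi> :: "'a csup \<Rightarrow> 'a sup_end" where phi: "csup_phi \<phi>" using ex1_csup_phi by blast
  interpret csup_data lact ract \<phi> using bim phi by (rule csup_data.intro)
  show "\<exists>!mult :: 'a csup \<Rightarrow> 'a csup \<Rightarrow> 'a csup. csup_mult mult"
    using csup_mult_lact_phi csup_mult_unique by blast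
  show "\<exists>!act :: ('a sup_end \<Rightarrow> 'a csup \<Rightarrow> 'a csup) \<times> ('a csup \<Rightarrow> 'a sup_end \<Rightarrow> 'a csup).
      csup_bimodule (fst act) (snd act)"
    by (rule ex1I[of _ "(lact, ract)"])
      (use bim csup_bimodule_unique in \<open>auto simp: prod_eq_iff\<close>)
  show "\<exists>!\<phi> :: 'a csup \<Rightarrow> 'a sup_end. csup_phi \<phi>" by (rule ex1_csup_phi)
next
  fix mult :: "'a csup \<Rightarrow> 'a csup \<Rightarrow> 'a csup" 
    and lact :: "'a sup_end \<Rightarrow> 'a csup \<Rightarrow> 'a csup" and ract and \<phi> :: "'a csup \<Rightarrow> 'a sup_end"
  assume mult: "csup_mult mult" and "csup_bimodule lact ract" "csup_phi \<phi>"
  then interpret csup_data lact ract \<phi> by (intro csup_data.intro)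
  show "strong_couple mult comp_end lact ract \<phi>" using mult by (rule strong_couple)
  show "girard_couple mult comp_end lact ract \<phi>" using mult by (rule girard_couple)
  show "cyclic lact ract (csup_d :: 'a csup)" by (rule cyclic_csup_d)
  show "dualizing lact ract (csup_d :: 'a csup)" by (rule dualizing_csup_d)
qed

end
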